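(* Let $n\ge 0$. If $xy=u_1u_2$ and $x+y=u_3+u_4$, then $$\widetilde{A}_n(x,y,t\,|\,\alpha)=\sum_{\sigma\in\mathcal{M}_{n+1}}(u_1u_2)^{\mathrm{val}(\sigma)}u_3^{\mathrm{da}(\sigma)}u_4^{\mathrm{dd}(\sigma)}t^{\mathrm{lmaxda}(\sigma)+\mathrm{rmaxdd}(\sigma)}\alpha^{\mathrm{lmax}(\sigma)+\mathrm{rmax}(\sigma)-2}.$$
   Context: $\mathfrak{S}_m$ is the symmetric group on $[m]$; permutations are written as words $\sigma=\sigma_1\cdots\sigma_m$. $\mathcal{M}_m$ is the set of $\sigma\in\mathfrak{S}_m$ such that the first descent (if any) of $\sigma$ appears at the letter $m$, i.e. if $i$ is the smallest index with $\sigma_i>\sigma_{i+1}$ then $\sigma_i=m$ (e.g. $\mathcal{M}_3=\{123,132,231,312,321\}$). $\mathrm{asc}$ (resp. $\mathrm{des}$) is the number of $1\le i\le m-1$ with $\sigma_i<\sigma_{i+1}$ (resp. $\sigma_i>\sigma_{i+1}$). With the convention $\sigma_0=\sigma_{m+1}=0$, a letter $\sigma_i$ ($1\le i\le m$) is a valley if $\sigma_{i-1}>\sigma_i<\sigma_{i+1}$, a double ascent if $\sigma_{i-1}<\sigma_i<\sigma_{i+1}$, a double descent if $\sigma_{i-1}>\sigma_i>\sigma_{i+1}$; their numbers are $\mathrm{val},\mathrm{da},\mathrm{dd}$. $\sigma_i$ is a left-to-right (resp. right-to-left) maximum if it is larger than all letters of $\sigma$ to its left (resp. right); $\mathrm{lmax},\mathrm{rmax}$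 are their numbers. $\mathrm{lmaxda}$ is the number of left-to-right maxima that are double ascents and $\mathrm{rmaxdd}$ the number of right-to-left maxima that are double descents. The $(\alpha,t)$-binomial-Eulerian polynomials are $$\widetilde{A}_n(x,y,t\,|\,\alpha)=\sum_{\sigma\in\mathcal{M}_{n+1}}x^{\mathrm{asc}(\sigma)}y^{\mathrm{des}(\sigma)}t^{\mathrm{lmaxda}(\sigma)+\mathrm{rmaxdd}(\sigma)}\alpha^{\mathrm{lmax}(\sigma)+\mathrm{rmax}(\sigma)-2}.$$ All letters $x,y,u_i,t,\alpha$ are commuting variables. *)

theory Defs
  imports "HOL-Combinatorics.Multiset_Permutations"
begin

text \<open>
  A permutation of \<open>{1..m}\<close> is its word, i.e. an element of \<open>permutations_of_set {1..m}\<close>.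
  Positions are counted from 1, and \<open>letter \<sigma> 0 = letter \<sigma> (length \<sigma> + 1) = 0\<close>.
\<close>

definition letter :: "nat list \<Rightarrow> nat \<Rightarrow> nat" where
  "letter \<sigma> i = (if 1 \<le> i \<and> i \<le> length \<sigma> then \<sigma> ! (i - 1) else 0)"

definition ascents :: "nat list \<Rightarrow> nat set" where
  "ascents \<sigma> = {i. 1 \<le> i \<and> i < length \<sigma> \<and> letter \<sigma> i < letter \<sigma> (i + 1)}"

definition descents :: "nat list \<Rightarrow> nat set" where
  "descents \<sigma> = {i. 1 \<le> i \<and> i < length \<sigma> \<and> letter \<sigma> i > letter \<sigma> (i + 1)}"

definition first_descent_max_perms :: "nat \<Rightarrow> nat list set" where
  "first_descent_max_perms m =
     {\<sigma> \<in> permutations_of_set {1..m}.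
        descents \<sigma> \<noteq> {} \<longrightarrow> letter \<sigma> (Min (descents \<sigma>)) = m}"

text \<open>
  The sets below collect positions; as the letters of a permutation are distinct,
  counting positions is the same as counting letters.
\<close>

definition valleys :: "nat list \<Rightarrow> nat set" where
  "valleys \<sigma> = {i \<in> {1..length \<sigma>}.
     letter \<sigma> (i - 1) > letter \<sigma> i \<and> letter \<sigma> i < letter \<sigma> (i + 1)}"

definition double_ascents :: "nat list \<Rightarrow> nat set" where
  "double_ascents \<sigma> = {i \<in> {1..length \<sigma>}.
     letter \<sigma> (i - 1) < letter \<sigma> i \<and> letter \<sigma> i < letter \<sigma> (i + 1)}"

definition double_descents :: "nat list \<Rightarrow> nat set" where
  "double_descents \<sigma> = {i \<in> {1..length \<sigma>}.
     letter \<sigma> (i - 1) > letter \<sigma> i \<and> letter \<sigma> i > letter \<sigma> (i + 1)}"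

definition lr_maxima :: "nat list \<Rightarrow> nat set" where
  "lr_maxima \<sigma> = {i \<in> {1..length \<sigma>}. \<forall>j\<in>{1..<i}. letter \<sigma> j < letter \<sigma> i}"

definition rl_maxima :: "nat list \<Rightarrow> nat set" where
  "rl_maxima \<sigma> = {i \<in> {1..length \<sigma>}. \<forall>j\<in>{i<..length \<sigma>}. letter \<sigma> j < letter \<sigma> i}"

definition asc :: "nat list \<Rightarrow> nat" where "asc \<sigma> = card (ascents \<sigma>)"

definition des :: "nat list \<Rightarrow> nat" where "des \<sigma> = card (descents \<sigma>)"

definition val :: "nat list \<Rightarrow> nat" where "val \<sigma> = card (valleys \<sigma>)"

definition da :: "nat list \<Rightarrow> nat" where "da \<sigma> = card (double_ascents \<sigma>)"

definition dd :: "nat list \<Rightarrow> nat" where "dd \<sigma> = card (double_descents \<sigma>)"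

definition lmax :: "nat list \<Rightarrow> nat" where "lmax \<sigma> = card (lr_maxima \<sigma>)"

definition rmax :: "nat list \<Rightarrow> nat" where "rmax \<sigma> = card (rl_maxima \<sigma>)"

definition lmaxda :: "nat list \<Rightarrow> nat" where
  "lmaxda \<sigma> = card (lr_maxima \<sigma> \<inter> double_ascents \<sigma>)"

definition rmaxdd :: "nat list \<Rightarrow> nat" where
  "rmaxdd \<sigma> = card (rl_maxima \<sigma> \<inter> double_descents \<sigma>)"

text \<open>
  The subtraction in the exponent of \<open>\<alpha>\<close> never truncates: a nonempty word has
  at least one left-to-right and one right-to-left maximum.
\<close>

definition binomial_Eulerian ::
    "nat \<Rightarrow> 'a::comm_ring_1 \<Rightarrow> 'a \<Rightarrow> 'a \<Rightarrow> 'a \<Rightarrow> 'a" where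
  "binomial_Eulerian n x y t \<alpha> =
     (\<Sum>\<sigma>\<in>first_descent_max_perms (n + 1).
        x ^ asc \<sigma> * y ^ des \<sigma> * t ^ (lmaxda \<sigma> + rmaxdd \<sigma>) * \<alpha> ^ (lmax \<sigma> + rmax \<sigma> - 2))"

end

theory Submission
  imports Defs
begin

text \<open>
  Write \<open>m = n + 1\<close>. In the interior of a permutation every ascent starts at a valley or at a
  double ascent, and every descent ends at a valley or at a double descent, so
  \<open>asc = val + da\<close> and \<open>des = val + dd\<close>, whence
  \<open>x ^ asc * y ^ des = (x * y) ^ val * x ^ da * y ^ dd\<close>. Both sides of the identity are therefore
  values of one weighted sum, in which a valley has weight \<open>p\<close>, a double ascent weight \<open>a\<close> and a
  double descent weight \<open>b\<close>, and what must be shown is that this sum depends on \<open>a\<close> and \<open>b\<close> only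
  through \<open>a + b\<close>.

  A permutation counted here is a word \<open>L m R\<close> with \<open>L\<close> increasing
  (\<open>first_descent_max_iff_sorted_prefix\<close>). Each letter of \<open>L\<close> is a double ascent and a left-to-right
  maximum and contributes \<open>a * t * \<alpha>\<close>. Let \<open>K(S)\<close> (\<open>total_sum\<close>) be the weighted sum over all
  words \<open>L m R\<close> in which \<open>S\<close> is the set of letters other than \<open>m\<close>, and let \<open>G(U)\<close> (\<open>block_sum\<close>)
  be the weighted sum over the arrangements of \<open>U\<close> between two letters that exceed all of \<open>U\<close>.
  The place of the largest letter \<open>M\<close> gives recursions for both.

  For \<open>K(insert M S)\<close>: if \<open>M\<close> is in \<open>L\<close> it is the last letter of \<open>L\<close> and contributes
  \<open>a * t * \<alpha>\<close>. If \<open>M\<close> is the first letter of \<open>R\<close> it is a double descent and a right-to-left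
  maximum and contributes \<open>b * t * \<alpha>\<close>. In both cases the other letters feel no difference when
  \<open>M\<close> is deleted. Otherwise \<open>R = u M v\<close> with \<open>u\<close> nonempty, and \<open>M\<close> is a peak and a right-to-left
  maximum, with weight \<open>\<alpha>\<close>; the word \<open>u\<close> lies between the larger letters \<open>m\<close> and \<open>M\<close>. Hence
  \<open>K(insert M S) = (a + b) * t * \<alpha> * K(S) + (\<Sum>U. \<alpha> * G(U) * K(S - U))\<close>, over the nonempty
  \<open>U \<subseteq> S\<close>.

  For \<open>G(insert M S)\<close> with \<open>S\<close> nonempty, \<open>M\<close> is a double ascent when it comes last, a double
  descent when it comes first, and a peak otherwise, so
  \<open>G(insert M S) = (a + b) * G(S) + (\<Sum>U. G(U) * G(S - U))\<close>, over the nonempty proper subsets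
  \<open>U\<close> of \<open>S\<close>, while \<open>G({M}) = p\<close>. Induction on the set finishes the proof, first for \<open>G\<close>
  (\<open>block_sum_cong\<close>) and then for \<open>K\<close> (\<open>total_sum_cong\<close>).
\<close>

section \<open>Splitting permutations at a letter\<close>

lemma sum_permutations_split:
  assumes "finite S" "x \<in> S"
  shows "(\<Sum>w\<in>permutations_of_set S. f w) =
    (\<Sum>U\<in>Pow (S - {x}). \<Sum>u\<in>permutations_of_set U.
       \<Sum>v\<in>permutations_of_set (S - {x} - U). f (u @ x # v))"
proof -
  have fin: "finite U" if "U \<in> Pow (S - {x})" for U
    using that assms(1) finite_subset by auto
  have "(\<Sum>U\<in>Pow (S - {x}). \<Sum>u\<in>permutations_of_set U.
       \<Sum>v\<in>permutations_of_set (S - {x} - U). f (u @ x # v)) =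
     (\<Sum>(U, u, v)\<in>Sigma (Pow (S - {x})) (\<lambda>U. permutations_of_set U \<times>
        permutations_of_set (S - {x} - U)). f (u @ x # v))"
    using assms(1) fin by (simp add: sum.Sigma sum.cartesian_product)
  also have "\<dots> = (\<Sum>w\<in>permutations_of_set S. f w)"
  proof (rule sum.reindex_bij_witness[where
        i = "\<lambda>w. (set (takeWhile (\<lambda>z. z \<noteq> x) w), takeWhile (\<lambda>z. z \<noteq> x) w,
                   tl (dropWhile (\<lambda>z. z \<noteq> x) w))"
      and j = "\<lambda>(U, u, v). u @ x # v"], goal_cases)
    case (1 c)
    then obtain U u v where c: "c = (U, u, v)" "set u = U" "x \<notin> set u"
      by (auto simp: permutations_of_set_def)
    have tw: "takeWhile (\<lambda>z. z \<noteq> x) (u @ x # v) = u" "dropWhile (\<lambda>z. z \<noteq> x) (u @ x # v) = x # v"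
      using c by (auto simp: takeWhile_append dropWhile_append)
    show ?case
      using c tw by simp
  next
    case (2 c)
    then obtain U u v where c: "c = (U, u, v)" "U \<subseteq> S - {x}"
        "set u = U" "distinct u" "set v = S - {x} - U" "distinct v"
      by (auto simp: permutations_of_set_def)
    have "set (u @ x # v) = S"
      using c assms(2) by auto
    moreover have "distinct (u @ x # v)"
      using c by auto
    ultimately show ?case
      using c(1) by (simp add: permutations_of_set_def)
  next
    case (3 w)
    then have "x \<in> set w"
      using assms(2) by (auto simp: permutations_of_set_def)
    then obtain u v where "w = u @ x # v" "x \<notin> set u"
      by (meson split_list_first)
    then show ?case
      by (simp add: takeWhile_append dropWhile_append)
  next
    case (4 w)
    then have "x \<in> set w"
      using assms(2) by (auto simp: permutations_of_set_def)
    then obtain u v where uv: "w = u @ x # v" "x \<notin> set u"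
      by (meson split_list_first)
    have tw: "takeWhile (\<lambda>z. z \<noteq> x) (u @ x # v) = u" "dropWhile (\<lambda>z. z \<noteq> x) (u @ x # v) = x # v"
      using uv by (auto simp: takeWhile_append dropWhile_append)
    show ?case
      using 4 uv unfolding uv(1) tw by (auto simp: permutations_of_set_def)
  next
    case (5 c)
    then show ?case by (cases c) auto
  qed
  finally show ?thesis by simp
qed

lemma letter_append_left: "1 \<le> i \<Longrightarrow> i \<le> length u \<Longrightarrow> letter (u @ v) i = u ! (i - 1)"
  by (cases i) (simp_all add: letter_def nth_append)

text \<open>
  A descent inside \<open>u\<close> would come before the letter \<open>m\<close>; and as \<open>m\<close> is the largest letter,
  it is not the bottom of a descent, but it is the top of one as soon as \<open>v\<close> is nonempty.
\<close>

lemma first_descent_max_iff_sorted_prefix: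
  assumes "u @ m # v \<in> permutations_of_set {1..m}"
  shows "u @ m # v \<in> first_descent_max_perms m \<longleftrightarrow> sorted u"
proof -
  let ?w = "u @ m # v"
  have less: "z < m" if "z \<in> set u \<union> set v" for z
    using assms that by (fastforce simp: permutations_of_set_def set_eq_iff less_le)
  have fin: "finite (descents ?w)"
    by (rule finite_subset[of _ "{..length ?w}"]) (auto simp: descents_def)
  have lm: "letter ?w (length u + 1) = m"
    by (simp add: letter_def nth_append)
  have ne: "letter ?w i \<noteq> m" if "1 \<le> i" "i \<le> length u" for i
    using that less[of "u ! (i - 1)"] by (auto simp: letter_append_left)
  show ?thesis
  proof
    assume "?w \<in> first_descent_max_perms m"
    then have fd: "descents ?w \<noteq> {} \<Longrightarrow> letter ?w (Min (descents ?w)) = m"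
      by (simp add: first_descent_max_perms_def)
    show "sorted u"
    proof (rule ccontr)
      assume "\<not> sorted u"
      then obtain i where i: "Suc i < length u" "u ! i > u ! Suc i"
        by (auto simp: sorted_iff_nth_Suc not_le)
      then have d: "Suc i \<in> descents ?w"
        by (auto simp: descents_def letter_append_left)
      then have le: "Min (descents ?w) \<le> Suc i" and mem: "Min (descents ?w) \<in> descents ?w"
        using fin by (auto intro: Min_in)
      have "1 \<le> Min (descents ?w)"
        using mem unfolding descents_def by blast
      then show False
        using ne[of "Min (descents ?w)"] fd d le i by auto
    qed
  next
    assume s: "sorted u"
    have ge: "i \<ge> length u + 1" if "i \<in> descents ?w" for i
    proof (rule ccontr)
      assume "\<not> ?thesis"
      then have i: "1 \<le> i" "i \<le> length u" and gt: "letter ?w (i + 1) < letter ?w i"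
        using that by (auto simp: descents_def)
      show False
      proof (cases "i = length u")
        case True
        then show False using gt lm less[of "u ! (i - 1)"] i by (auto simp: letter_append_left)
      next
        case False
        then show False
          using gt i sorted_nth_mono[OF s, of "i - 1" i] by (auto simp: letter_append_left)
      qed
    qed
    have "letter ?w (Min (descents ?w)) = m" if "descents ?w \<noteq> {}"
    proof -
      obtain i where "i \<in> descents ?w" using \<open>descents ?w \<noteq> {}\<close> by blast
      then have "v \<noteq> []" using ge[of i] by (auto simp: descents_def)
      then have "length u + 1 \<in> descents ?w"
        using less[of "hd v"] by (cases v) (auto simp: descents_def letter_def nth_append)
      then have "Min (descents ?w) = length u + 1"
        using ge fin by (intro Min_eqI) auto
      then show ?thesis using lm by simp
    qed
    then show "?w \<in> first_descent_max_perms m"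
      using assms by (simp add: first_descent_max_perms_def)
  qed
qed

lemma sum_first_descent_max_perms:
  fixes f :: "nat list \<Rightarrow> 'a::comm_monoid_add"
  shows "(\<Sum>\<sigma>\<in>first_descent_max_perms (n + 1). f \<sigma>) =
    (\<Sum>A\<in>Pow {1..n}. \<Sum>v\<in>permutations_of_set ({1..n} - A).
       f (sorted_list_of_set A @ (n + 1) # v))"
proof -
  let ?S = "{1..n + 1}" and ?M = "first_descent_max_perms (n + 1)"
  have S: "?S - {n + 1} = {1..n}" by auto
  have "(\<Sum>\<sigma>\<in>?M. f \<sigma>) = (\<Sum>\<sigma>\<in>permutations_of_set ?S. if \<sigma> \<in> ?M then f \<sigma> else 0)"
    by (rule sum.mono_neutral_cong_left) (auto simp: first_descent_max_perms_def)
  also have "\<dots> = (\<Sum>A\<in>Pow {1..n}. \<Sum>u\<in>permutations_of_set A.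
      \<Sum>v\<in>permutations_of_set ({1..n} - A).
        if u @ (n + 1) # v \<in> ?M then f (u @ (n + 1) # v) else 0)"
    by (subst sum_permutations_split[of _ "n + 1"], simp, simp, simp only: S)
  also have "\<dots> = (\<Sum>A\<in>Pow {1..n}. \<Sum>u\<in>permutations_of_set A.
      if u = sorted_list_of_set A
      then \<Sum>v\<in>permutations_of_set ({1..n} - A). f (u @ (n + 1) # v) else 0)"
  proof (intro sum.cong refl, goal_cases)
    case (1 A u)
    have "u @ (n + 1) # v \<in> ?M \<longleftrightarrow> u = sorted_list_of_set A"
      if "v \<in> permutations_of_set ({1..n} - A)" for v
    proof -
      have "u @ (n + 1) # v \<in> permutations_of_set {1..n + 1}"
        using 1 that by (auto simp: permutations_of_set_def)
      moreover have "sorted u \<longleftrightarrow> u = sorted_list_of_set A"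
        using permutations_of_setD[OF 1(2)] sorted_sorted_list_of_set
          sorted_list_of_set.idem_if_sorted_distinct by metis
      ultimately show ?thesis
        using first_descent_max_iff_sorted_prefix by metis
    qed
    then show ?case by (auto intro: sum.cong sum.neutral)
  qed
  also have "\<dots> = (\<Sum>A\<in>Pow {1..n}. \<Sum>v\<in>permutations_of_set ({1..n} - A).
       f (sorted_list_of_set A @ (n + 1) # v))"
  proof (rule sum.cong, rule refl, goal_cases)
    case (1 A)
    then have "finite A" using finite_subset by auto
    then have "sorted_list_of_set A \<in> permutations_of_set A"
      by (auto simp: permutations_of_set_def)
    then show ?case by (simp add: \<open>finite A\<close> sum.delta)
  qed
  finally show ?thesis .
qed

section \<open>Weights of words in a context\<close>

locale letter_weights =
  fixes p a b t \<alpha> :: "'a::comm_ring_1"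
begin

text \<open>
  The factor contributed by the letter \<open>x\<close> when \<open>pre\<close> is everything to its left and \<open>post\<close>
  everything to its right. The default \<open>0\<close> for a missing neighbour is the convention
  \<open>\<sigma>\<^sub>0 = \<sigma>\<^sub>m\<^sub>+\<^sub>1 = 0\<close>. A letter that is a maximum in both directions, which in a permutation of
  \<open>{1..m}\<close> is exactly the letter \<open>m\<close>, receives no \<open>\<alpha>\<close>: this accounts for the \<open>- 2\<close> in the
  exponent \<open>lmax + rmax - 2\<close>.
\<close>

definition letter_weight :: "nat list \<Rightarrow> nat \<Rightarrow> nat list \<Rightarrow> 'a" where
  "letter_weight pre x post =
    (let l = last (0 # pre); r = hd (post @ [0]);
         lr = (\<forall>z\<in>set pre. z < x); rl = (\<forall>z\<in>set post. z < x)
     in (if l > x \<and> x < r then p else 1)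
        * (if l < x \<and> x < r then a * (if lr then t else 1) else 1)
        * (if l > x \<and> x > r then b * (if rl then t else 1) else 1)
        * (if lr \<noteq> rl then \<alpha> else 1))"

text \<open>
  Keeping the surroundings \<open>pre\<close> and \<open>post\<close> as arguments makes the weight of a concatenation the
  product of the weights of its parts, each taken in its own surroundings.
\<close>

fun word_weight :: "nat list \<Rightarrow> nat list \<Rightarrow> nat list \<Rightarrow> 'a" where
  "word_weight pre [] post = 1"
| "word_weight pre (x # xs) post =
     letter_weight pre x (xs @ post) * word_weight (pre @ [x]) xs post"

lemma word_weight_append:
  "word_weight pre (u @ v) post = word_weight pre u (v @ post) * word_weight (pre @ u) v post"
  by (induction u arbitrary: pre) (simp_all add: mult.assoc)

lemma word_weight_eq_prod:
  "word_weight pre w post =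
    (\<Prod>i<length w. letter_weight (pre @ take i w) (w ! i) (drop (Suc i) w @ post))"
  by (induction w arbitrary: pre) (simp_all add: prod.lessThan_Suc_shift del: prod.lessThan_Suc)

text \<open>
  A letter larger than all of \<open>w\<close> shields \<open>w\<close> from what lies beyond it: no letter of \<open>w\<close> can be a
  maximum in that direction, and the size of the shield does not affect comparisons with its
  neighbour in \<open>w\<close>.
\<close>

lemma word_weight_shielded_left:
  assumes "\<forall>z\<in>set w. z < N \<and> z < N'"
  shows "word_weight (pre @ [N]) w post = word_weight (pre' @ [N']) w post"
proof -
  have "letter_weight (pre @ N # take i w) (w ! i) (drop (Suc i) w @ post) =
        letter_weight (pre' @ N' # take i w) (w ! i) (drop (Suc i) w @ post)"
    if i: "i < length w" for i
  proof -
    have lt: "w ! i < N" "w ! i < N'" using assms i by auto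
    have l: "last (N # take i w) > w ! i \<longleftrightarrow> last (N' # take i w) > w ! i"
            "last (N # take i w) < w ! i \<longleftrightarrow> last (N' # take i w) < w ! i"
      using lt by (auto simp: take_eq_Nil)
    have lr: "(\<forall>z\<in>set (pre @ N # take i w). z < w ! i) = False"
             "(\<forall>z\<in>set (pre' @ N' # take i w). z < w ! i) = False"
      using lt by (auto simp: not_less intro: less_imp_le)
    have la: "last (0 # pre @ N # take i w) = last (N # take i w)"
             "last (0 # pre' @ N' # take i w) = last (N' # take i w)" by auto
    show ?thesis
      unfolding letter_weight_def Let_def la l lr ..
  qed
  then show ?thesis
    by (simp add: word_weight_eq_prod)
qed

lemma word_weight_shielded_right:
  assumes "\<forall>z\<in>set w. z < M \<and> z < M'"
  shows "word_weight pre w (M # post) = word_weight pre w (M' # post')"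
proof -
  have "letter_weight (pre @ take i w) (w ! i) (drop (Suc i) w @ M # post) =
        letter_weight (pre @ take i w) (w ! i) (drop (Suc i) w @ M' # post')"
    if i: "i < length w" for i
  proof -
    let ?d = "drop (Suc i) w"
    have lt: "w ! i < M" "w ! i < M'" using assms i by auto
    have r: "hd ((?d @ M # post) @ [0]) > w ! i \<longleftrightarrow> hd ((?d @ M' # post') @ [0]) > w ! i"
            "hd ((?d @ M # post) @ [0]) < w ! i \<longleftrightarrow> hd ((?d @ M' # post') @ [0]) < w ! i"
      using lt by (cases ?d; simp)+
    have rl: "(\<forall>z\<in>set (?d @ M # post). z < w ! i) = False"
             "(\<forall>z\<in>set (?d @ M' # post'). z < w ! i) = False"
      using lt by (auto simp: not_less intro: less_imp_le)
    show ?thesis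
      unfolding letter_weight_def Let_def r rl ..
  qed
  then show ?thesis
    by (simp add: word_weight_eq_prod)
qed

section \<open>Recursions by the position of the largest letter\<close>

text \<open>
  Here \<open>N\<close> is any letter larger than those of \<open>S\<close>: \<open>block_sum\<close> sums over the words enclosed by
  large letters on both sides, \<open>tail_sum\<close> over the words that follow a large letter and end the
  permutation, and \<open>total_sum\<close> over all words \<open>L N R\<close> with \<open>L\<close> increasing and with \<open>S\<close> as the set of
  their other letters (\<open>sum_word_weight_first_descent_max_perms\<close>).
\<close>

definition block_sum :: "nat \<Rightarrow> nat set \<Rightarrow> 'a" where
  "block_sum N S = (\<Sum>w\<in>permutations_of_set S. word_weight [N] w [N])"

definition tail_sum :: "nat \<Rightarrow> nat set \<Rightarrow> 'a" where
  "tail_sum N S = (\<Sum>w\<in>permutations_of_set S. word_weight [N] w [])"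

definition total_sum :: "nat \<Rightarrow> nat set \<Rightarrow> 'a" where
  "total_sum N S = (\<Sum>A\<in>Pow S. (a * t * \<alpha>) ^ card A * tail_sum N (S - A))"

lemma block_sum_empty [simp]: "block_sum N {} = 1"
  by (simp add: block_sum_def)

lemma tail_sum_empty [simp]: "tail_sum N {} = 1"
  by (simp add: tail_sum_def)

lemma total_sum_empty [simp]: "total_sum N {} = 1"
  by (simp add: total_sum_def)

text \<open>
  In the recursions \<open>U\<close> is the set of letters to the left of the largest letter \<open>M\<close> of the
  given set (in \<open>total_sum_rec\<close>: those between \<open>N\<close> and \<open>M\<close>), and the \<open>if\<close>-expression is the factor contributed by
  \<open>M\<close> itself. As a neighbour of \<open>M\<close> is either a smaller letter or the boundary, that factor depends
  only on which sides of \<open>M\<close> are empty.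
\<close>

lemma block_sum_rec:
  assumes "finite S" "\<forall>z\<in>S. z < M" "M < N"
  shows "block_sum N (insert M S) =
    (\<Sum>U\<in>Pow S. (if U = {} \<and> S = {} then p else if U = {} then b else if U = S then a else 1)
       * block_sum N U * block_sum N (S - U))"
proof -
  have M: "M \<notin> S" using assms by auto
  have "block_sum N (insert M S) = (\<Sum>U\<in>Pow S. \<Sum>u\<in>permutations_of_set U.
       \<Sum>v\<in>permutations_of_set (S - U). word_weight [N] (u @ M # v) [N])"
    unfolding block_sum_def using assms M by (subst sum_permutations_split[of _ M]) auto
  also have "\<dots> = (\<Sum>U\<in>Pow S. \<Sum>u\<in>permutations_of_set U. \<Sum>v\<in>permutations_of_set (S - U).
      (if U = {} \<and> S = {} then p else if U = {} then b else if U = S then a else 1) *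
      (word_weight [N] u [N] * word_weight [N] v [N]))"
  proof (intro sum.cong refl, goal_cases)
    case (1 U u v)
    then have u: "set u = U" and v: "set v = S - U" and US: "U \<subseteq> S"
      by (auto simp: permutations_of_set_def)
    have su: "\<forall>z\<in>set u. z < N \<and> z < M" and sv: "\<forall>z\<in>set v. z < N \<and> z < M"
      using u v US assms by fastforce+
    have e: "U = {} \<longleftrightarrow> u = []" "U = S \<longleftrightarrow> v = []" using u v US by auto
    have e2: "S = {} \<longleftrightarrow> u = [] \<and> v = []" using e u v US by auto
    have l: "last (0 # N # u) = (if u = [] then N else last u)" by simp
    have r: "hd ((v @ [N]) @ [0]) = (if v = [] then N else hd v)" by (cases v) auto
    have lu: "u \<noteq> [] \<Longrightarrow> last u < M" and hv: "v \<noteq> [] \<Longrightarrow> hd v < M"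
      using su sv by auto
    have lr: "(\<forall>z\<in>set (N # u). z < M) = False" "(\<forall>z\<in>set (v @ [N]). z < M) = False"
      using assms by auto
    have m: "letter_weight (N # u) M (v @ [N]) =
      (if U = {} \<and> S = {} then p else if U = {} then b else if U = S then a else 1)"
      unfolding letter_weight_def Let_def l r lr e e2 using lu hv assms(3)
      by (auto simp: not_less_iff_gr_or_eq)
    have wu: "word_weight [N] u (M # v @ [N]) = word_weight [N] u [N]"
      using su by (intro word_weight_shielded_right) auto
    have wv: "word_weight (N # u @ [M]) v [N] = word_weight [N] v [N]"
      using word_weight_shielded_left[where w = v and N = M and N' = N
          and pre = "N # u" and pre' = "[]" and post = "[N]"] sv by auto
    show ?case
      by (simp add: word_weight_append wu wv m mult_ac)
  qed
  also have "\<dots> = (\<Sum>U\<in>Pow S. (if U = {} \<and> S = {} then p else if U = {} then b else if U = S then a else 1)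
       * block_sum N U * block_sum N (S - U))"
    by (simp add: block_sum_def sum_product mult.assoc flip: sum_distrib_left)
  finally show ?thesis .
qed

lemma tail_sum_rec:
  assumes "finite S" "\<forall>z\<in>S. z < M" "0 < M" "M < N"
  shows "tail_sum N (insert M S) =
    (\<Sum>U\<in>Pow S. (if U = {} then b * t * \<alpha> else \<alpha>) * block_sum N U * tail_sum N (S - U))"
proof -
  have M: "M \<notin> S" using assms by auto
  have "tail_sum N (insert M S) = (\<Sum>U\<in>Pow S. \<Sum>u\<in>permutations_of_set U.
       \<Sum>v\<in>permutations_of_set (S - U). word_weight [N] (u @ M # v) [])"
    unfolding tail_sum_def using assms M by (subst sum_permutations_split[of _ M]) auto
  also have "\<dots> = (\<Sum>U\<in>Pow S. \<Sum>u\<in>permutations_of_set U. \<Sum>v\<in>permutations_of_set (S - U).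
      (if U = {} then b * t * \<alpha> else \<alpha>) *
      (word_weight [N] u [N] * word_weight [N] v []))"
  proof (intro sum.cong refl, goal_cases)
    case (1 U u v)
    then have u: "set u = U" and v: "set v = S - U" and US: "U \<subseteq> S"
      by (auto simp: permutations_of_set_def)
    have su: "\<forall>z\<in>set u. z < N \<and> z < M" and sv: "\<forall>z\<in>set v. z < N \<and> z < M"
      using u v US assms by fastforce+
    have e: "U = {} \<longleftrightarrow> u = []" using u by auto
    have l: "last (0 # N # u) = (if u = [] then N else last u)" by simp
    have r: "hd (v @ [0]) < M" using sv assms(3) by (cases v) auto
    have lu: "u \<noteq> [] \<Longrightarrow> last u < M" using su by auto
    have lr: "(\<forall>z\<in>set (N # u). z < M) = False" "(\<forall>z\<in>set v. z < M) = True"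
      using assms sv by auto
    have m: "letter_weight (N # u) M v = (if U = {} then b * t * \<alpha> else \<alpha>)"
      unfolding letter_weight_def Let_def l lr e using lu r assms(4)
      by (auto simp: not_less_iff_gr_or_eq)
    have wu: "word_weight [N] u (M # v) = word_weight [N] u [N]"
      using su by (intro word_weight_shielded_right) auto
    have wv: "word_weight (N # u @ [M]) v [] = word_weight [N] v []"
      using word_weight_shielded_left[where w = v and N = M and N' = N
          and pre = "N # u" and pre' = "[]" and post = "[]"] sv by auto
    show ?case
      by (simp add: word_weight_append wu wv m mult_ac)
  qed
  also have "\<dots> = (\<Sum>U\<in>Pow S. (if U = {} then b * t * \<alpha> else \<alpha>)
       * block_sum N U * tail_sum N (S - U))"
    by (simp add: block_sum_def tail_sum_def sum_product mult.assoc flip: sum_distrib_left)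
  finally show ?thesis .
qed


text \<open>
  The first summand collects the words with \<open>M\<close> in the increasing prefix; for the others, the
  sum over the prefix \<open>A\<close> is exchanged with that over the set \<open>U\<close> from \<open>tail_sum_rec\<close>.
\<close>

lemma total_sum_rec:
  assumes "finite S" "\<forall>z\<in>S. z < M" "0 < M" "M < N"
  shows "total_sum N (insert M S) = a * t * \<alpha> * total_sum N S +
    (\<Sum>U\<in>Pow S. (if U = {} then b * t * \<alpha> else \<alpha>) * block_sum N U * total_sum N (S - U))"
proof -
  let ?c = "a * t * \<alpha>"
  let ?g = "\<lambda>U. (if U = {} then b * t * \<alpha> else \<alpha>) * block_sum N U"
  let ?F = "\<lambda>A. ?c ^ card A * tail_sum N (insert M S - A)"
  have M: "M \<notin> S" using assms by auto
  have fin: "finite A" if "A \<subseteq> S" for A using that assms(1) finite_subset by auto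
  have disj: "Pow S \<inter> insert M ` Pow S = {}" using M by auto
  have inj: "inj_on (insert M) (Pow S)"
    using M by (auto simp: inj_on_def)
  have "total_sum N (insert M S) = sum ?F (insert M ` Pow S) + sum ?F (Pow S)"
    unfolding total_sum_def Pow_insert using assms(1) disj
    by (subst sum.union_disjoint) auto
  also have "sum ?F (insert M ` Pow S) = (\<Sum>A\<in>Pow S. ?c * (?c ^ card A * tail_sum N (S - A)))"
  proof (subst sum.reindex[OF inj], intro sum.cong refl, goal_cases)
    case (1 A)
    then have "M \<notin> A" "finite A" using M fin by auto
    moreover have "insert M S - insert M A = S - A" using M by auto
    ultimately show ?case by (simp add: mult.assoc)
  qed
  also have "\<dots> = ?c * total_sum N S"
    by (simp add: total_sum_def sum_distrib_left)
  also have "sum ?F (Pow S) = (\<Sum>A\<in>Pow S. \<Sum>U | U \<in> Pow S \<and> A \<inter> U = {}.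
      ?c ^ card A * (?g U * tail_sum N (S - A - U)))"
  proof (intro sum.cong refl, goal_cases)
    case (1 A)
    then have A: "insert M S - A = insert M (S - A)" "finite (S - A)" "\<forall>z\<in>S - A. z < M"
      using M assms by auto
    have P: "Pow (S - A) = {U. U \<in> Pow S \<and> A \<inter> U = {}}" by auto
    show ?case
      unfolding A(1) tail_sum_rec[OF A(2,3) assms(3,4)] P by (simp add: sum_distrib_left)
  qed
  also have "\<dots> = (\<Sum>U\<in>Pow S. \<Sum>A | A \<in> Pow S \<and> A \<inter> U = {}.
      ?c ^ card A * (?g U * tail_sum N (S - A - U)))"
    using assms(1) by (intro sum.swap_restrict) auto
  also have "\<dots> = (\<Sum>U\<in>Pow S. ?g U * total_sum N (S - U))"
  proof (intro sum.cong refl, goal_cases)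
    case (1 U)
    have P: "{A. A \<in> Pow S \<and> A \<inter> U = {}} = Pow (S - U)" by auto
    have "S - A - U = S - U - A" for A by auto
    then show ?case
      unfolding P total_sum_def by (simp add: sum_distrib_left mult_ac)
  qed
  finally show ?thesis .
qed

section \<open>Permutation statistics as weights\<close>

text \<open>
  The sortedness assumption includes a leading \<open>0\<close>, the conventional left neighbour, so that also
  the first letter is a double ascent.
\<close>

lemma word_weight_increasing_prefix:
  assumes "sorted_wrt (<) (0 # pre @ u @ [N])"
  shows "word_weight pre u (N # v) = (a * t * \<alpha>) ^ length u"
  using assms
proof (induction u arbitrary: pre)
  case (Cons x xs)
  have "last (0 # pre) < x" "\<forall>z\<in>set pre. z < x" "x < N"
    using Cons.prems by (auto simp: sorted_wrt_append)
  moreover have "x < hd ((xs @ N # v) @ [0])"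
    using Cons.prems by (cases xs) (auto simp: sorted_wrt_append)
  ultimately have "letter_weight pre x (xs @ N # v) = a * t * \<alpha>"
    by (auto simp: letter_weight_def Let_def)
  then show ?case using Cons by simp
qed simp

lemma word_weight_increasing_max:
  assumes "sorted_wrt (<) (0 # u @ [N])" "\<forall>z\<in>set v. z < N"
  shows "word_weight [] (u @ N # v) [] = (a * t * \<alpha>) ^ length u * word_weight [N] v []"
proof -
  have "last (0 # u) < N" "\<forall>z\<in>set u. z < N"
    using assms(1) by (auto simp: sorted_wrt_append)
  moreover have "hd (v @ [0]) < N"
    using assms by (cases v) auto
  ultimately have "letter_weight u N v = 1"
    using assms(2) by (auto simp: letter_weight_def Let_def)
  moreover have "word_weight (u @ [N]) v [] = word_weight [N] v []"
    using word_weight_shielded_left[where pre' = "[]"] assms(2) by auto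
  ultimately show ?thesis
    using word_weight_increasing_prefix[of "[]" u N v] assms(1) by (simp add: word_weight_append)
qed

lemma sum_word_weight_first_descent_max_perms:
  "(\<Sum>\<sigma>\<in>first_descent_max_perms (n + 1). word_weight [] \<sigma> []) = total_sum (n + 1) {1..n}"
  unfolding sum_first_descent_max_perms total_sum_def tail_sum_def sum_distrib_left
proof (intro sum.cong refl, goal_cases)
  case (1 A v)
  then have "finite A" using finite_subset by auto
  then have "sorted_wrt (<) (0 # sorted_list_of_set A @ [n + 1])"
    using 1 by (auto simp: sorted_wrt_append)
  moreover have "\<forall>z\<in>set v. z < n + 1"
    using 1 by (auto simp: permutations_of_set_def)
  ultimately show ?case
    using word_weight_increasing_max by simp
qed

lemma word_weight_statistics:
  assumes "\<sigma> \<in> permutations_of_set {1..m}" "0 < m"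
  shows "word_weight [] \<sigma> [] = p ^ val \<sigma> * a ^ da \<sigma> * b ^ dd \<sigma>
    * t ^ (lmaxda \<sigma> + rmaxdd \<sigma>) * \<alpha> ^ (lmax \<sigma> + rmax \<sigma> - 2)"
proof -
  let ?I = "{1..length \<sigma>}"
  let ?D = "(lr_maxima \<sigma> - rl_maxima \<sigma>) \<union> (rl_maxima \<sigma> - lr_maxima \<sigma>)"
  have prod_if: "(\<Prod>i\<in>?I. if i \<in> A then c else 1) = c ^ card A" if "A \<subseteq> ?I" for A and c :: 'a
  proof -
    have "?I \<inter> {i. i \<in> A} = A" using that by auto
    then show ?thesis by (simp add: prod.If_cases)
  qed
  have "word_weight [] \<sigma> [] =
      (\<Prod>i\<in>?I. letter_weight (take (i - 1) \<sigma>) (letter \<sigma> i) (drop i \<sigma>))"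
    unfolding word_weight_eq_prod One_nat_def prod.atLeast1_atMost_eq
    by (intro prod.cong) (auto simp: letter_def)
  also have "\<dots> = (\<Prod>i\<in>?I. (if i \<in> valleys \<sigma> then p else 1)
      * (if i \<in> double_ascents \<sigma> then a else 1)
      * (if i \<in> lr_maxima \<sigma> \<inter> double_ascents \<sigma> then t else 1)
      * (if i \<in> double_descents \<sigma> then b else 1)
      * (if i \<in> rl_maxima \<sigma> \<inter> double_descents \<sigma> then t else 1)
      * (if i \<in> ?D then \<alpha> else 1))"
  proof (intro prod.cong refl, goal_cases)
    case (1 i)
    have l: "last (0 # take (i - 1) \<sigma>) = letter \<sigma> (i - 1)"
      using 1 by (auto simp: letter_def last_conv_nth)
    have r: "hd (drop i \<sigma> @ [0]) = letter \<sigma> (i + 1)"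
      by (auto simp: letter_def hd_append hd_drop_conv_nth)
    have lr: "(\<forall>z\<in>set (take (i - 1) \<sigma>). z < letter \<sigma> i) \<longleftrightarrow> i \<in> lr_maxima \<sigma>"
    proof -
      have "set (take (i - 1) \<sigma>) = letter \<sigma> ` {1..<i}"
      proof -
        have "set (take (i - 1) \<sigma>) = (!) \<sigma> ` {..<i - 1}"
          using 1 by (subst nth_image[symmetric]) (auto simp: lessThan_atLeast0)
        also have "\<dots> = letter \<sigma> ` Suc ` {..<i - 1}"
          unfolding image_image using 1 by (intro image_cong) (auto simp: letter_def)
        also have "Suc ` {..<i - 1} = {1..<i}"
          using 1 by (cases i) (auto simp: image_Suc_lessThan lessThan_Suc_atMost)
        finally show ?thesis .
      qed
      then show ?thesis using 1 by (auto simp: lr_maxima_def)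
    qed
    have rl: "(\<forall>z\<in>set (drop i \<sigma>). z < letter \<sigma> i) \<longleftrightarrow> i \<in> rl_maxima \<sigma>"
    proof -
      have "set (drop i \<sigma>) = letter \<sigma> ` {i<..length \<sigma>}"
      proof (intro equalityI subsetI)
        fix z assume "z \<in> set (drop i \<sigma>)"
        then obtain k where "k < length \<sigma> - i" "z = \<sigma> ! (i + k)"
          by (auto simp: in_set_conv_nth)
        then show "z \<in> letter \<sigma> ` {i<..length \<sigma>}"
          by (intro image_eqI[of _ _ "i + k + 1"]) (auto simp: letter_def)
      next
        fix z assume "z \<in> letter \<sigma> ` {i<..length \<sigma>}"
        then obtain j where j: "i < j" "j \<le> length \<sigma>" "z = \<sigma> ! (j - 1)"
          by (auto simp: letter_def)
        then show "z \<in> set (drop i \<sigma>)"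
          unfolding in_set_conv_nth by (intro exI[of _ "j - 1 - i"]) auto
      qed
      then show ?thesis using 1 by (auto simp: rl_maxima_def)
    qed
    show ?case
      unfolding letter_weight_def Let_def l r lr rl using 1
      by (auto simp: valleys_def double_ascents_def double_descents_def)
  qed
  also have "\<dots> = p ^ card (valleys \<sigma>) * a ^ card (double_ascents \<sigma>)
      * t ^ card (lr_maxima \<sigma> \<inter> double_ascents \<sigma>) * b ^ card (double_descents \<sigma>)
      * t ^ card (rl_maxima \<sigma> \<inter> double_descents \<sigma>) * \<alpha> ^ card ?D"
    unfolding prod.distrib
    by (intro arg_cong2[where f = "(*)"] prod_if)
      (auto simp: valleys_def double_ascents_def double_descents_def lr_maxima_def rl_maxima_def)
  also have "card ?D = lmax \<sigma> + rmax \<sigma> - 2"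
    \<comment> \<open>Only the letter \<open>m\<close> is a maximum in both directions.\<close>
  proof -
    have "m \<in> set \<sigma>" "distinct \<sigma>" and le: "\<forall>z\<in>set \<sigma>. z \<le> m"
      using assms by (auto simp: permutations_of_set_def)
    then obtain k where k: "k < length \<sigma>" "\<sigma> ! k = m"
      by (auto simp: in_set_conv_nth)
    have less: "letter \<sigma> j < m" if "j \<noteq> Suc k" for j
    proof -
      have "letter \<sigma> j \<le> m" using le by (auto simp: letter_def)
      moreover have "letter \<sigma> j \<noteq> m"
        using that k \<open>distinct \<sigma>\<close> assms(2) by (auto simp: letter_def nth_eq_iff_index_eq)
      ultimately show ?thesis by simp
    qed
    have lk: "letter \<sigma> (Suc k) = m" using k by (simp add: letter_def)
    have "lr_maxima \<sigma> \<inter> rl_maxima \<sigma> = {Suc k}"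
    proof (intro equalityI subsetI)
      fix i assume i: "i \<in> lr_maxima \<sigma> \<inter> rl_maxima \<sigma>"
      show "i \<in> {Suc k}"
      proof (rule ccontr)
        assume "i \<notin> {Suc k}"
        then have "letter \<sigma> (Suc k) < letter \<sigma> i"
          using i k by (cases "Suc k < i") (auto simp: lr_maxima_def rl_maxima_def)
        then show False using less[of i] lk \<open>i \<notin> {Suc k}\<close> by simp
      qed
    next
      fix i assume "i \<in> {Suc k}"
      then show "i \<in> lr_maxima \<sigma> \<inter> rl_maxima \<sigma>"
        using less lk k by (auto simp: lr_maxima_def rl_maxima_def)
    qed
    moreover have fin: "finite (lr_maxima \<sigma>)" "finite (rl_maxima \<sigma>)"
      by (auto simp: lr_maxima_def rl_maxima_def)
    moreover have "card ?D = card (lr_maxima \<sigma> - rl_maxima \<sigma>) + card (rl_maxima \<sigma> - lr_maxima \<sigma>)"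
      using fin by (intro card_Un_disjoint) auto
    moreover from calculation have "0 < card (lr_maxima \<sigma>)" "0 < card (rl_maxima \<sigma>)"
      unfolding card_gt_0_iff by blast+
    ultimately show ?thesis
      using card_Diff_subset_Int[of "lr_maxima \<sigma>" "rl_maxima \<sigma>"]
        card_Diff_subset_Int[of "rl_maxima \<sigma>" "lr_maxima \<sigma>"]
      by (simp add: lmax_def rmax_def Int_commute)
  qed
  finally show ?thesis
    by (simp add: val_def da_def dd_def lmaxda_def rmaxdd_def power_add mult_ac)
qed

end

section \<open>Dependence on the sum of two letter weights\<close>

text \<open>
  In the recursions for \<open>block_sum\<close> and \<open>total_sum\<close> the letter \<open>M\<close> brings in \<open>a\<close> from one of its
  positions and \<open>b\<close> from another; deleting \<open>M\<close> leaves the same sum in both cases, so only \<open>a + b\<close>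
  matters.
\<close>

lemma block_sum_cong:
  fixes a b a' b' :: "'a::comm_ring_1"
  assumes "a + b = a' + b'" "finite S" "\<forall>z\<in>S. z < N"
  shows "letter_weights.block_sum p a b t \<alpha> N S = letter_weights.block_sum p a' b' t \<alpha> N S"
proof -
  interpret W: letter_weights p a b t \<alpha> .
  interpret W': letter_weights p a' b' t \<alpha> .
  show ?thesis using assms(2,3)
  proof (induction rule: finite_psubset_induct)
    case (psubset S)
    show ?case
    proof (cases "S = {}")
      case False
      define M where "M = Max S"
      define T where "T = S - {M}"
      have MS: "M \<in> S" using psubset False by (simp add: M_def)
      then have S: "S = insert M T" by (auto simp: T_def)
      have T: "finite T" "\<forall>z\<in>T. z < M" "M < N"
        using psubset MS by (auto simp: T_def M_def order.not_eq_order_implies_strict)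
      have IH: "W.block_sum N U = W'.block_sum N U" if "U \<subseteq> T" for U
      proof (rule psubset.IH)
        show "U \<subset> S" using that MS by (auto simp: T_def)
        then show "\<forall>z\<in>U. z < N" using psubset.prems by auto
      qed
      show ?thesis
      proof (cases "T = {}")
        case True
        then show ?thesis
          using W.block_sum_rec[OF T] W'.block_sum_rec[OF T] by (simp add: S)
      next
        case False
        \<comment> \<open>\<open>U = {}\<close> and \<open>U = T\<close> are distinct subsets, so both terms can be split off.\<close>
        have eq: "(\<Sum>U\<in>Pow T. (if U = {} \<and> T = {} then p else if U = {} then d
              else if U = T then c else 1) * g U * g (T - U)) =
            (c + d) * (g {} * g T) + (\<Sum>U\<in>Pow T - {{}, T}. g U * g (T - U))"
          for c d :: 'a and g
        proof -
          have "Pow T = insert {} (insert T (Pow T - {{}, T}))" by auto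
          then have "(\<Sum>U\<in>Pow T. h U) = h {} + (h T + (\<Sum>U\<in>Pow T - {{}, T}. h U))"
            for h :: "nat set \<Rightarrow> 'a"
            using False T(1)
            by (metis (no_types, lifting) DiffE finite_Diff finite_Pow_iff finite_insert
                insertCI insertE sum.insert)
          moreover have "(\<Sum>U\<in>Pow T - {{}, T}. (if U = {} \<and> T = {} then p else if U = {} then d
              else if U = T then c else 1) * g U * g (T - U)) =
              (\<Sum>U\<in>Pow T - {{}, T}. g U * g (T - U))"
            by (intro sum.cong) auto
          ultimately show ?thesis using False by (simp add: algebra_simps)
        qed
        have "W.block_sum N S = (a + b) * W'.block_sum N T
            + (\<Sum>U\<in>Pow T - {{}, T}. W'.block_sum N U * W'.block_sum N (T - U))"
          unfolding S W.block_sum_rec[OF T] eq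
          by (intro arg_cong2[where f = "(+)"] arg_cong2[where f = "(*)"] sum.cong refl)
            (auto simp: IH)
        also have "\<dots> = W'.block_sum N S"
          unfolding S W'.block_sum_rec[OF T] eq assms(1) by simp
        finally show ?thesis .
      qed
    qed simp
  qed
qed

lemma total_sum_cong:
  fixes a b a' b' :: "'a::comm_ring_1"
  assumes "a + b = a' + b'" "finite S" "\<forall>z\<in>S. 0 < z \<and> z < N"
  shows "letter_weights.total_sum p a b t \<alpha> N S = letter_weights.total_sum p a' b' t \<alpha> N S"
proof -
  interpret W: letter_weights p a b t \<alpha> .
  interpret W': letter_weights p a' b' t \<alpha> .
  show ?thesis using assms(2,3)
  proof (induction rule: finite_psubset_induct)
    case (psubset S)
    show ?case
    proof (cases "S = {}")
      case False
      define M where "M = Max S"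
      define T where "T = S - {M}"
      have MS: "M \<in> S" using psubset False by (simp add: M_def)
      then have S: "S = insert M T" by (auto simp: T_def)
      have T: "finite T" "\<forall>z\<in>T. z < M" "0 < M" "M < N"
        using psubset MS by (auto simp: T_def M_def order.not_eq_order_implies_strict)
      have IH: "W.total_sum N U = W'.total_sum N U" if "U \<subseteq> T" for U
      proof (rule psubset.IH)
        show "U \<subset> S" using that MS by (auto simp: T_def)
        then show "\<forall>z\<in>U. 0 < z \<and> z < N" using psubset.prems by auto
      qed
      have G: "W.block_sum N U = W'.block_sum N U" if "U \<subseteq> T" for U
      proof (rule block_sum_cong[OF assms(1)])
        show "finite U" using that T(1) finite_subset by auto
        show "\<forall>z\<in>U. z < N" using that T by fastforce
      qed
      have eq: "c * t * \<alpha> * k T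
          + (\<Sum>U\<in>Pow T. (if U = {} then d * t * \<alpha> else \<alpha>) * g U * k (T - U)) =
          (c + d) * t * \<alpha> * k T + (\<Sum>U\<in>Pow T - {{}}. \<alpha> * g U * k (T - U))"
        if "g {} = 1" for c d :: 'a and g k
      proof -
        have "(\<Sum>U\<in>Pow T - {{}}. (if U = {} then d * t * \<alpha> else \<alpha>) * g U * k (T - U)) =
            (\<Sum>U\<in>Pow T - {{}}. \<alpha> * g U * k (T - U))"
          by (intro sum.cong) auto
        then show ?thesis
          using T(1) that by (simp add: sum.remove[of "Pow T" "{}"] distrib_right)
      qed
      have "W.total_sum N S = (a + b) * t * \<alpha> * W'.total_sum N T
          + (\<Sum>U\<in>Pow T - {{}}. \<alpha> * W'.block_sum N U * W'.total_sum N (T - U))"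
        unfolding S W.total_sum_rec[OF T] eq[of "W.block_sum N", OF W.block_sum_empty]
        by (intro arg_cong2[where f = "(+)"] arg_cong2[where f = "(*)"] sum.cong refl)
          (auto simp: IH G)
      also have "\<dots> = W'.total_sum N S"
        unfolding S W'.total_sum_rec[OF T] eq[of "W'.block_sum N", OF W'.block_sum_empty] assms(1) ..
      finally show ?thesis .
    qed simp
  qed
qed

section \<open>Ascents and descents\<close>

text \<open>
  This covers both ends: letters of a permutation of \<open>{1..m}\<close> are positive, hence differ from the
  conventional \<open>0\<close> next to them.
\<close>

lemma letter_permutation_neq:
  assumes "\<sigma> \<in> permutations_of_set {1..m}" "\<sigma> \<noteq> []" "i \<le> length \<sigma>"
  shows "letter \<sigma> i \<noteq> letter \<sigma> (Suc i)"
proof -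
  have d: "distinct \<sigma>" and "\<forall>z\<in>set \<sigma>. 0 < z"
    using assms(1) by (auto simp: permutations_of_set_def)
  then have pos: "0 < \<sigma> ! j" if "j < length \<sigma>" for j
    using that by auto
  show ?thesis
    using assms(2,3) d pos[of 0] pos[of "i - 1"]
    by (cases i) (auto simp: letter_def nth_eq_iff_index_eq Suc_le_eq)
qed

text \<open>
  An ascent is counted at its lower letter, which is a valley or a double ascent according to its
  left neighbour; a descent \<open>i\<close> is counted at its lower letter \<open>i + 1\<close>.
\<close>

lemma asc_eq_val_plus_da:
  assumes "\<sigma> \<in> permutations_of_set {1..m}"
  shows "asc \<sigma> = val \<sigma> + da \<sigma>"
proof -
  have "ascents \<sigma> = valleys \<sigma> \<union> double_ascents \<sigma>"
  proof (intro equalityI subsetI)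
    fix i assume i: "i \<in> ascents \<sigma>"
    then have "letter \<sigma> (i - 1) \<noteq> letter \<sigma> i"
      using letter_permutation_neq[OF assms, of "i - 1"]
      by (cases i; cases "\<sigma> = []") (auto simp: ascents_def)
    then show "i \<in> valleys \<sigma> \<union> double_ascents \<sigma>"
      using i by (auto simp: ascents_def valleys_def double_ascents_def)
  next
    fix i assume i: "i \<in> valleys \<sigma> \<union> double_ascents \<sigma>"
    then have "i \<noteq> length \<sigma>"
      by (auto simp: valleys_def double_ascents_def letter_def)
    then show "i \<in> ascents \<sigma>"
      using i by (auto simp: ascents_def valleys_def double_ascents_def)
  qed
  then show ?thesis
    unfolding asc_def val_def da_def
    by (simp, intro card_Un_disjoint) (auto simp: valleys_def double_ascents_def)
qed

lemma des_eq_val_plus_dd: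
  assumes "\<sigma> \<in> permutations_of_set {1..m}"
  shows "des \<sigma> = val \<sigma> + dd \<sigma>"
proof -
  have "Suc ` descents \<sigma> = valleys \<sigma> \<union> double_descents \<sigma>"
  proof (intro equalityI subsetI)
    fix j assume "j \<in> Suc ` descents \<sigma>"
    then obtain i where i: "j = Suc i" "i \<in> descents \<sigma>" by auto
    then have "letter \<sigma> j \<noteq> letter \<sigma> (j + 1)"
      using letter_permutation_neq[OF assms, of j] by (cases "\<sigma> = []") (auto simp: descents_def)
    then show "j \<in> valleys \<sigma> \<union> double_descents \<sigma>"
      using i by (auto simp: descents_def valleys_def double_descents_def)
  next
    fix j assume j: "j \<in> valleys \<sigma> \<union> double_descents \<sigma>"
    then have "letter \<sigma> (j - 1) \<noteq> 0"
      by (auto simp: valleys_def double_descents_def)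
    then have "j - 1 \<noteq> 0" by (auto simp: letter_def)
    then show "j \<in> Suc ` descents \<sigma>"
      using j by (intro image_eqI[of _ _ "j - 1"])
        (auto simp: descents_def valleys_def double_descents_def)
  qed
  then have "card (descents \<sigma>) = card (valleys \<sigma> \<union> double_descents \<sigma>)"
    by (metis card_image inj_Suc inj_on_subset subset_UNIV)
  also have "\<dots> = card (valleys \<sigma>) + card (double_descents \<sigma>)"
    by (intro card_Un_disjoint) (auto simp: valleys_def double_descents_def)
  finally show ?thesis
    unfolding des_def val_def dd_def .
qed

section \<open>The identity\<close>

theorem theorem2p3:
  fixes n :: nat
    and x y u\<^sub>1 u\<^sub>2 u\<^sub>3 u\<^sub>4 t \<alpha> :: "'a::comm_ring_1"
  assumes "x * y = u\<^sub>1 * u\<^sub>2"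
    and "x + y = u\<^sub>3 + u\<^sub>4"
  shows "binomial_Eulerian n x y t \<alpha> =
    (\<Sum>\<sigma>\<in>first_descent_max_perms (n + 1).
       (u\<^sub>1 * u\<^sub>2) ^ val \<sigma> * u\<^sub>3 ^ da \<sigma> * u\<^sub>4 ^ dd \<sigma>
         * t ^ (lmaxda \<sigma> + rmaxdd \<sigma>) * \<alpha> ^ (lmax \<sigma> + rmax \<sigma> - 2))"
proof -
  interpret W: letter_weights "x * y" x y t \<alpha> .
  interpret W': letter_weights "u\<^sub>1 * u\<^sub>2" u\<^sub>3 u\<^sub>4 t \<alpha> .
  have perm: "\<sigma> \<in> permutations_of_set {1..n + 1}" if "\<sigma> \<in> first_descent_max_perms (n + 1)" for \<sigma>
    using that by (simp add: first_descent_max_perms_def)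
  have "binomial_Eulerian n x y t \<alpha> =
      (\<Sum>\<sigma>\<in>first_descent_max_perms (n + 1). W.word_weight [] \<sigma> [])"
    unfolding binomial_Eulerian_def
  proof (intro sum.cong refl, goal_cases)
    case (1 \<sigma>)
    show ?case
      using asc_eq_val_plus_da[OF perm[OF 1]] des_eq_val_plus_dd[OF perm[OF 1]]
        W.word_weight_statistics[OF perm[OF 1]]
      by (simp add: power_add power_mult_distrib mult_ac)
  qed
  also have "\<dots> = W.total_sum (n + 1) {1..n}"
    by (rule W.sum_word_weight_first_descent_max_perms)
  also have "\<dots> = W'.total_sum (n + 1) {1..n}"
    unfolding assms(1) by (rule total_sum_cong[OF assms(2)]) auto
  also have "\<dots> = (\<Sum>\<sigma>\<in>first_descent_max_perms (n + 1). W'.word_weight [] \<sigma> [])"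
    by (rule W'.sum_word_weight_first_descent_max_perms[symmetric])
  also have "\<dots> = (\<Sum>\<sigma>\<in>first_descent_max_perms (n + 1).
       (u\<^sub>1 * u\<^sub>2) ^ val \<sigma> * u\<^sub>3 ^ da \<sigma> * u\<^sub>4 ^ dd \<sigma>
         * t ^ (lmaxda \<sigma> + rmaxdd \<sigma>) * \<alpha> ^ (lmax \<sigma> + rmax \<sigma> - 2))"
    using perm by (intro sum.cong refl W'.word_weight_statistics) auto
  finally show ?thesis .
qed

end
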